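(* Assume that the normal operator $\overline{L}$ is of finite rank, that the true function lies inside the function space of identifiability $H=\mathrm{Null}(\overline{L})^\perp$, and that perturbations outside $H$ are present, as follows: (i) the operator $\overline{L}$ has descending eigenvalues satisfying $\lambda_i=0$ for all $i>K$ and $\lambda_K>0$; (ii) the term $\phi^y$ is approximated by $\widetilde\phi^y$ such that $\widetilde\phi^y=\phi^y+\phi^\epsilon$ with $\phi^\epsilon\in\mathrm{Null}(\overline{L})$, $\phi^\epsilon\neq0$; (iii) the true function is $\phi_*=\sum_{1\le i\le K}c_i\psi_i$, where $\{\psi_i\}$ are the orthonormal eigenfunctions of $\overline{L}$ corresponding to $\{\lambda_i\}$. Then, when $\sigma\to0$, the conventional $L^2$-regularized estimator $$\widetilde\phi_\lambda^{L^2}=(\overline{L}+\lambda I)^{-1}\widetilde\phi^y$$ has a non-vanishing bias; in contrast, the fractional Sobolev space regularized estimator $$\widetilde\phi_\lambda^{s}=(\overline{L}+\lambda\overline{L}^{-s})^{-1}\widetilde\phi^y$$ has a vanishing bias.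
   Context: $\rho$ is a probability measure with compact support and $\mathbb{Y}$ is a Hilbert space. For a fixed $n$, $L_k:L^2_\rho\to\mathbb{Y}$, $k=1,\dots,n$, are bounded linear operators with adjoints $L_k^*$, and the data are $y_k=L_k\phi_*+\sigma\dot W_k$, where $\phi_*$ is the true function, $\dot W_k$ is white noise on $\mathbb{Y}$ (that is, $\langle\dot W_k,y\rangle_{\mathbb{Y}}\sim\mathcal{N}(0,\|y\|_{\mathbb{Y}}^2)$ for each $y\in\mathbb{Y}$), and $\sigma>0$ is the noise strength. The normal operator is $\overline{L}=\frac1n\sum_{k=1}^nL_k^*L_k:L^2_\rho\to L^2_\rho$, which is positive semidefinite and self-adjoint, and $\phi^y=\frac1n\sum_{k=1}^nL_k^*y_k$. Here $\lambda>0$ is the regularization hyper-parameter, $s\ge0$ is a smoothness parameter, and $I$ is the identity on $L^2_\rho$. Negative powers of $\overline{L}$ are pseudo-inverses. The operator $(\overline{L}+\lambda\overline{L}^{-s})^{-1}$ comes from minimizing the loss $\frac1n\sum_k\|L_k\phi-y_k\|_{\mathbb{Y}}^2$ plus the penalty $\lambda\|\overline{L}^{-s/2}\phi\|_{L^2_\rho}^2$ within $\overline{L}^{s/2}(L^2_\rho)\subset H$ (for $s=0$, within $H$). It acts on $H$ by $\psi_i\mapsto(\lambda_i+\lambda\lambda_i^{-s})^{-1}\psi_i$ for $i\le K$, and it removes components in $\mathrm{Null}(\overline{L})$. The word "bias" of an estimator $\widetilde\phi_\lambda$ refers to the expected squared error $\mathbb{E}[\|\widetilde\phi_\lambda-\phi_*\|_{L^2_\rho}^2]$,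 considered at its minimal value over $\lambda>0$; it is vanishing if this tends to $0$ as $\sigma\to0$.
   Formalization: The non-vanishing bias of the L²-regularized estimator is stated only for a nonzero true function: when it is zero, letting λ tend to infinity makes the expected squared error tend to 0 for every σ, so the claim fails there. The vanishing-bias claim needs no such restriction. *)

theory Defs
  imports "HOL-Probability.Probability"
begin

section \<open>The space of square-integrable functions\<close>

definition measure_support :: "'x::topological_space measure \<Rightarrow> 'x set" where
  "measure_support \<rho> = {x. \<forall>U. open U \<and> x \<in> U \<longrightarrow> emeasure \<rho> U > 0}"

definition square_integrable :: "'x measure \<Rightarrow> ('x \<Rightarrow> real) set" where
  "square_integrable \<rho> = {f \<in> borel_measurable \<rho>. integrable \<rho> (\<lambda>x. (f x)\<^sup>2)}"

(* HOL has no type depending on a measure, so the quotient of the square-integrable functions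
   by almost everywhere equality is described as a Hilbert space type 'h together with the
   class map f |-> [f].  The last clause forces [f] = [g] iff f = g almost everywhere, so 'h is
   L^2(\<rho>) up to isometric isomorphism. *)
definition is_L2_space ::
    "'x measure \<Rightarrow> (('x \<Rightarrow> real) \<Rightarrow> 'h::{real_inner,complete_space}) \<Rightarrow> bool" where
  "is_L2_space \<rho> cls \<longleftrightarrow>
     cls ` square_integrable \<rho> = UNIV \<and>
     (\<forall>f\<in>square_integrable \<rho>. \<forall>g\<in>square_integrable \<rho>. \<forall>a b.
        cls (\<lambda>x. a * f x + b * g x) = a *\<^sub>R cls f + b *\<^sub>R cls g) \<and>
     (\<forall>f\<in>square_integrable \<rho>. \<forall>g\<in>square_integrable \<rho>.
        inner (cls f) (cls g) = (LINT x|\<rho>. f x * g x))"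


section \<open>Operators on Hilbert spaces\<close>

definition null_space :: "('a::real_inner \<Rightarrow> 'b::real_inner) \<Rightarrow> 'a set" where
  "null_space T = {f. T f = 0}"

definition normal_operator ::
    "nat \<Rightarrow> (nat \<Rightarrow> 'h::real_inner \<Rightarrow> 'y::real_inner) \<Rightarrow> 'h \<Rightarrow> 'h" where
  "normal_operator n L f = (1 / real n) *\<^sub>R (\<Sum>k=1..n. adjoint (L k) (L k f))"

(* Orthonormal eigenfunctions \<psi> i of T with eigenvalues mu i, forming a complete system.  The
   space may be finite-dimensional, hence the two possible shapes of the index set. *)
definition orthonormal_eigenbasis ::
    "('h::real_inner \<Rightarrow> 'h) \<Rightarrow> nat set \<Rightarrow> (nat \<Rightarrow> real) \<Rightarrow> (nat \<Rightarrow> 'h) \<Rightarrow> bool" where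
  "orthonormal_eigenbasis T J mu \<psi> \<longleftrightarrow>
     (J = {1..} \<or> (\<exists>d. J = {1..d})) \<and>
     (\<forall>i\<in>J. \<forall>j\<in>J. inner (\<psi> i) (\<psi> j) = (if i = j then 1 else 0)) \<and>
     closure (span (\<psi> ` J)) = UNIV \<and>
     (\<forall>i\<in>J. T (\<psi> i) = mu i *\<^sub>R \<psi> i)"

(* Moore-Penrose pseudo-inverse: the solution of the least squares problem T h = g that is
   orthogonal to the null space of T. *)
definition pseudo_inverse :: "('a::real_inner \<Rightarrow> 'b::real_inner) \<Rightarrow> 'b \<Rightarrow> 'a" where
  "pseudo_inverse T g =
     (THE h. h \<in> orthogonal_comp (null_space T) \<and> (\<forall>f. inner (T h - g) (T f) = 0))"

(* The power T^s (s \<ge> 0) of a positive semidefinite operator of rank K with nonzero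
   eigenvalues mu 1, ..., mu K and orthonormal eigenfunctions \<psi> 1, ..., \<psi> K.
   For s = 0 it is the orthogonal projection onto the complement of the null space. *)
definition operator_power ::
    "nat \<Rightarrow> (nat \<Rightarrow> real) \<Rightarrow> (nat \<Rightarrow> 'h::real_inner) \<Rightarrow> real \<Rightarrow> 'h \<Rightarrow> 'h" where
  "operator_power K mu \<psi> s f = (\<Sum>i=1..K. (mu i powr s * inner f (\<psi> i)) *\<^sub>R \<psi> i)"


section \<open>White noise and data\<close>

(* White noise is in general not a random element of 'y, only its pairings with elements of 'y
   make sense.  So W \<omega> y stands for the pairing of the noise with y.  The case y = 0, whose
   law is degenerate, is covered by linearity. *)
definition white_noise :: "'w measure \<Rightarrow> ('w \<Rightarrow> 'y::real_inner \<Rightarrow> real) \<Rightarrow> bool" where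
  "white_noise M W \<longleftrightarrow>
     (\<forall>\<omega>\<in>space M. linear (W \<omega>)) \<and>
     (\<forall>y. y \<noteq> 0 \<longrightarrow> distributed M lborel (\<lambda>\<omega>. W \<omega> y) (normal_density 0 (norm y)))"

(* The datum T \<phi> + \<sigma> (noise), as a linear functional on 'y. *)
definition noisy_datum ::
    "('h::real_inner \<Rightarrow> 'y::real_inner) \<Rightarrow> 'h \<Rightarrow> ('w \<Rightarrow> 'y \<Rightarrow> real) \<Rightarrow> real \<Rightarrow> 'w \<Rightarrow> 'y \<Rightarrow> real" where
  "noisy_datum T \<phi> W \<sigma> \<omega> = (\<lambda>y. inner (T \<phi>) y + \<sigma> * W \<omega> y)"

(* The adjoint extended to linear functionals on 'y; on \<eta> = inner y it is adjoint T y.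
   If T has finite rank, the required element exists for every linear \<eta>, bounded or not. *)
definition weak_adjoint :: "('h::real_inner \<Rightarrow> 'y::real_inner) \<Rightarrow> ('y \<Rightarrow> real) \<Rightarrow> 'h" where
  "weak_adjoint T \<eta> = (THE h. \<forall>f. inner h f = \<eta> (T f))"

definition \<phi>y ::
    "nat \<Rightarrow> (nat \<Rightarrow> 'h::real_inner \<Rightarrow> 'y::real_inner) \<Rightarrow> 'h \<Rightarrow> (nat \<Rightarrow> 'w \<Rightarrow> 'y \<Rightarrow> real) \<Rightarrow>
     real \<Rightarrow> 'w \<Rightarrow> 'h" where
  "\<phi>y n L \<phi>s W \<sigma> \<omega> =
     (1 / real n) *\<^sub>R (\<Sum>k=1..n. weak_adjoint (L k) (noisy_datum (L k) \<phi>s (W k) \<sigma> \<omega>))"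


section \<open>Regularized estimators and their bias\<close>

definition L2_regularized :: "('h::real_inner \<Rightarrow> 'h) \<Rightarrow> real \<Rightarrow> 'h \<Rightarrow> 'h" where
  "L2_regularized T lam g = inv (\<lambda>f. T f + lam *\<^sub>R f) g"

(* Both inverses are pseudo-inverses; T + lam T^(-s) has the same null space as T. *)
definition fractional_regularized ::
    "('h::real_inner \<Rightarrow> 'h) \<Rightarrow> nat \<Rightarrow> (nat \<Rightarrow> real) \<Rightarrow> (nat \<Rightarrow> 'h) \<Rightarrow> real \<Rightarrow> real \<Rightarrow> 'h \<Rightarrow> 'h" where
  "fractional_regularized T K mu \<psi> s lam g =
     pseudo_inverse (\<lambda>f. T f + lam *\<^sub>R pseudo_inverse (operator_power K mu \<psi> s) f) g"

(* est lam \<omega> is the estimator with hyper-parameter lam.  The expectation is taken in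
   [0, \<infinity>], so that it needs no integrability. *)
definition minimal_bias :: "'w measure \<Rightarrow> 'h::real_inner \<Rightarrow> (real \<Rightarrow> 'w \<Rightarrow> 'h) \<Rightarrow> ennreal" where
  "minimal_bias M \<phi>s est =
     (INF lam\<in>{0<..}. \<integral>\<^sup>+\<omega>. ennreal ((norm (est lam \<omega> - \<phi>s))\<^sup>2) \<partial>M)"

definition vanishing :: "(real \<Rightarrow> ennreal) \<Rightarrow> bool" where
  "vanishing b \<longleftrightarrow> (b \<longlongrightarrow> 0) (at_right 0)"

end

theory Submission
  imports Defs
begin

text \<open>
  The eigenbasis shows that \<open>Lbar\<close> is the finite diagonal operator with entries \<open>mu 1, \<dots>, mu K\<close>, and
  every \<open>L k\<close> vanishes on its null space. Hence \<open>\<phi>y\<close> has the coefficients \<open>mu i * c i + \<sigma> * \<xi> i\<close>, where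
  the \<open>\<xi> i\<close> are centred with finite second moments. The \<open>L\<^sup>2\<close> estimator divides them by \<open>mu i + lam\<close>
  and carries the perturbation along as \<open>\<phi>eps / lam\<close>: its expected squared error is at least
  \<open>(norm \<phi>eps)\<^sup>2\<close> for \<open>lam \<le> 1\<close> and at least \<open>(c i / (mu i + 1))\<^sup>2\<close> for \<open>lam \<ge> 1\<close>, whatever \<open>\<sigma>\<close>.
  The fractional estimator discards the perturbation and divides by \<open>mu i + lam * mu i powr (- s)\<close>;
  with \<open>lam = \<sigma>\<close> its error is \<open>O(\<sigma>)\<close> in mean square.
\<close>

section \<open>Riesz representation and adjoints\<close>

text \<open>The representing vector is the minimizer of \<open>(norm x)\<^sup>2 / 2 - f x\<close>; the parallelogram law
  makes every minimizing sequence a Cauchy sequence.\<close>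

lemma riesz_representation:
  fixes f :: "'h::{real_inner,complete_space} \<Rightarrow> real"
  assumes f: "bounded_linear f"
  obtains u where "\<And>x. f x = inner u x"
proof -
  interpret f: bounded_linear f by fact
  obtain B where B: "\<And>x. norm (f x) \<le> norm x * B" using f.bounded by blast
  define E where "E x = (norm x)\<^sup>2 / 2 - f x" for x
  \<comment> \<open>Completing the square in \<open>norm x\<close>, with the linear term controlled
    by the operator bound \<open>B\<close>.\<close>
  have lower: "- B\<^sup>2 / 2 \<le> E x" for x
  proof -
    have "f x \<le> norm x * B" using B[of x] by simp
    moreover have "0 \<le> (norm x - B)\<^sup>2" by simp
    ultimately show ?thesis by (simp add: E_def power2_eq_square algebra_simps)
  qed
  have bdd: "bdd_below (range E)" using lower by (intro bdd_belowI2)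
  define m where "m = Inf (range E)"
  have m_le: "m \<le> E x" for x unfolding m_def using bdd by (simp add: cInf_lower)
  have "\<exists>x. E x < m + 1 / real (Suc k)" for k
  proof (rule ccontr)
    assume "\<not> ?thesis"
    hence "m + 1 / real (Suc k) \<le> m"
      unfolding m_def by (intro cInf_greatest) (auto simp: not_less)
    moreover have "0 < 1 / real (Suc k)" by simp
    ultimately show False by linarith
  qed
  then obtain X where X: "\<And>k. E (X k) < m + 1 / real (Suc k)" by metis
  \<comment> \<open>The linear part \<open>f\<close> cancels between the two points and their
    midpoint, which leaves the parallelogram law. Since \<open>E\<close> is at least
    \<open>m\<close> at the midpoint, two near-minimizers must be close.\<close>
  have para: "(norm (a - b))\<^sup>2 / 4 = E a + E b - 2 * E ((1/2) *\<^sub>R (a + b))" for a b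
    by (simp add: E_def f.scaleR f.add power2_norm_eq_inner inner_simps inner_commute field_simps)
  have dist: "(norm (X j - X k))\<^sup>2 \<le> 4 * (1 / real (Suc j) + 1 / real (Suc k))" for j k
  proof -
    have "(norm (X j - X k))\<^sup>2 / 4 \<le> 1 / real (Suc j) + 1 / real (Suc k)"
      unfolding para using X[of j] X[of k] m_le[of "(1/2) *\<^sub>R (X j + X k)"] by argo
    thus ?thesis by simp
  qed
  have "Cauchy X"
  proof (rule CauchyI)
    fix e :: real assume e: "0 < e"
    obtain N where N: "1 / real (Suc N) < e\<^sup>2 / 8"
      using reals_Archimedean[of "e\<^sup>2 / 8"] e by (auto simp: inverse_eq_divide)
    have "norm (X j - X k) < e" if "N \<le> j" "N \<le> k" for j k
    proof -
      have "1 / real (Suc j) \<le> 1 / real (Suc N)" "1 / real (Suc k) \<le> 1 / real (Suc N)"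
        using that by (auto intro!: divide_left_mono)
      hence "(norm (X j - X k))\<^sup>2 < e\<^sup>2" using dist[of j k] N by argo
      thus ?thesis using e by (simp add: power2_less_imp_less)
    qed
    thus "\<exists>N. \<forall>j\<ge>N. \<forall>k\<ge>N. norm (X j - X k) < e" by blast
  qed
  then obtain u where u: "X \<longlonglongrightarrow> u" using Cauchy_convergent convergent_def by blast
  have "(\<lambda>k. E (X k)) \<longlonglongrightarrow> E u"
    unfolding E_def by (intro tendsto_intros u f.tendsto) auto
  moreover have "(\<lambda>k. m + 1 / real (Suc k)) \<longlonglongrightarrow> m + 0"
    by (intro tendsto_intros LIMSEQ_Suc lim_1_over_n)
  ultimately have "E u \<le> m + 0"
    by (rule LIMSEQ_le) (use X less_imp_le in blast)
  hence min: "E u \<le> E x" for x using m_le[of x] by simp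
  have "f v = inner u v" for v
  proof (cases "v = 0")
    case False
    define d where "d = inner u v - f v"
    \<comment> \<open>The minimizer of the quadratic
      \<open>t * d + t\<^sup>2 * (norm v)\<^sup>2 / 2\<close>. Its value is negative unless
      \<open>d = 0\<close>, which would contradict the minimality of \<open>u\<close>.\<close>
    define t where "t = - d / (norm v)\<^sup>2"
    have v: "(norm v)\<^sup>2 > 0" using False by simp
    have "(norm (u + t *\<^sub>R v))\<^sup>2 = (norm u)\<^sup>2 + 2 * t * inner u v + t\<^sup>2 * (norm v)\<^sup>2"
      unfolding power2_norm_eq_inner
      by (simp add: inner_add_left inner_add_right inner_commute power2_eq_square)
    hence "E (u + t *\<^sub>R v) = E u + t * d + t\<^sup>2 * (norm v)\<^sup>2 / 2"
      by (simp add: E_def d_def f.scaleR f.add field_simps)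
    hence "0 \<le> t * d + t\<^sup>2 * (norm v)\<^sup>2 / 2" using min[of "u + t *\<^sub>R v"] by linarith
    also have "\<dots> = - d\<^sup>2 / (2 * (norm v)\<^sup>2)"
      using v by (simp add: t_def power2_eq_square field_simps)
    finally have "d\<^sup>2 \<le> 0" using v by (simp add: field_simps)
    thus ?thesis by (simp add: d_def)
  qed (simp add: f.zero)
  thus thesis by (rule that)
qed

text \<open>\<open>adjoint T\<close> is a Hilbert choice, so its defining identity holds as soon as
  some function satisfies it; Riesz representation of \<open>x \<mapsto> inner (T x) y\<close>
  supplies one.\<close>

lemma inner_adjoint:
  fixes T :: "'a::{real_inner,complete_space} \<Rightarrow> 'b::real_inner"
  assumes T: "bounded_linear T"
  shows "inner (T x) y = inner x (adjoint T y)"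
proof -
  have "\<exists>u. \<forall>x. inner (T x) y = inner x u" for y
  proof -
    have "bounded_linear (\<lambda>x. inner (T x) y)"
      using bounded_linear_compose[OF bounded_linear_inner_left T] .
    then obtain u where "\<And>x. inner (T x) y = inner u x" using riesz_representation by blast
    thus ?thesis by (metis inner_commute)
  qed
  hence "\<exists>T'. \<forall>x y. inner (T x) y = inner x (T' y)" by metis
  hence "\<forall>x y. inner (T x) y = inner x (adjoint T y)"
    unfolding adjoint_def by (rule someI_ex)
  thus ?thesis by blast
qed

text \<open>The right-hand side is symmetric in \<open>f\<close> and \<open>g\<close> and
  nonnegative for \<open>f = g\<close>; self-adjointness and the null space of the normal operator
  are both read off from it.\<close>

lemma inner_normal_operator:
  fixes L :: "nat \<Rightarrow> 'h::{real_inner,complete_space} \<Rightarrow> 'y::real_inner"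
  assumes "\<And>k. k \<in> {1..n} \<Longrightarrow> bounded_linear (L k)"
  shows "inner (normal_operator n L f) g = (1 / real n) * (\<Sum>k=1..n. inner (L k f) (L k g))"
proof -
  have "inner (adjoint (L k) (L k f)) g = inner (L k f) (L k g)" if "k \<in> {1..n}" for k
    using inner_adjoint[OF assms[OF that]] by (metis inner_commute)
  thus ?thesis by (simp add: normal_operator_def inner_sum_left)
qed


section \<open>Finite diagonal operators\<close>

text \<open>The common shape of the normal operator, its powers and their pseudo-inverses. Linear
  combinations and pseudo-inverses stay within this family, so operator identities become identities
  between coefficients.\<close>

definition diagonal_operator ::
    "nat \<Rightarrow> (nat \<Rightarrow> 'h::real_inner) \<Rightarrow> (nat \<Rightarrow> real) \<Rightarrow> 'h \<Rightarrow> 'h" where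
  "diagonal_operator K \<psi> a f = (\<Sum>i=1..K. (a i * inner f (\<psi> i)) *\<^sub>R \<psi> i)"

lemma operator_power_eq_diagonal:
  "operator_power K mu \<psi> s = diagonal_operator K \<psi> (\<lambda>i. mu i powr s)"
  by (simp add: fun_eq_iff operator_power_def diagonal_operator_def)

lemma diagonal_operator_add_scaleR:
  "diagonal_operator K \<psi> a f + r *\<^sub>R diagonal_operator K \<psi> b f =
     diagonal_operator K \<psi> (\<lambda>i. a i + r * b i) f"
  by (simp add: diagonal_operator_def scaleR_sum_right algebra_simps flip: sum.distrib)

locale orthonormal_system =
  fixes K :: nat and \<psi> :: "nat \<Rightarrow> 'h::real_inner"
  assumes orthonormal: "i \<in> {1..K} \<Longrightarrow> j \<in> {1..K} \<Longrightarrow> inner (\<psi> i) (\<psi> j) = (if i = j then 1 else 0)"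
begin

lemma inner_sum_basis:
  assumes "j \<in> {1..K}"
  shows "inner (\<Sum>i=1..K. a i *\<^sub>R \<psi> i) (\<psi> j) = a j"
proof -
  have "inner (\<Sum>i=1..K. a i *\<^sub>R \<psi> i) (\<psi> j) = (\<Sum>i=1..K. if i = j then a i else 0)"
    unfolding inner_sum_left by (intro sum.cong refl) (use assms orthonormal in auto)
  thus ?thesis using assms by simp
qed

lemma norm_sum_basis: "(norm (\<Sum>i=1..K. a i *\<^sub>R \<psi> i))\<^sup>2 = (\<Sum>i=1..K. (a i)\<^sup>2)"
proof -
  have "(norm (\<Sum>i=1..K. a i *\<^sub>R \<psi> i))\<^sup>2 = (\<Sum>j=1..K. inner (\<Sum>i=1..K. a i *\<^sub>R \<psi> i) (a j *\<^sub>R \<psi> j))"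
    unfolding power2_norm_eq_inner by (subst inner_sum_right) rule
  also have "\<dots> = (\<Sum>j=1..K. (a j)\<^sup>2)"
    by (intro sum.cong refl) (simp only: inner_sum_basis inner_scaleR_right power2_eq_square)
  finally show ?thesis .
qed

lemma inner_diagonal_operator:
  "j \<in> {1..K} \<Longrightarrow> inner (diagonal_operator K \<psi> a f) (\<psi> j) = a j * inner f (\<psi> j)"
  unfolding diagonal_operator_def by (rule inner_sum_basis)

text \<open>The null space is the same for all choices of nonzero coefficients, so the penalized
  operator shares it with the normal operator.\<close>

lemma null_space_diagonal_operator:
  assumes "\<And>i. i \<in> {1..K} \<Longrightarrow> a i \<noteq> 0"
  shows "null_space (diagonal_operator K \<psi> a) = {f. \<forall>i\<in>{1..K}. inner f (\<psi> i) = 0}"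
proof safe
  fix f i assume "f \<in> null_space (diagonal_operator K \<psi> a)" and i: "i \<in> {1..K}"
  hence "inner (diagonal_operator K \<psi> a f) (\<psi> i) = 0" by (simp add: null_space_def)
  thus "inner f (\<psi> i) = 0" using assms[OF i] by (simp add: inner_diagonal_operator[OF i])
next
  fix f assume "\<forall>i\<in>{1..K}. inner f (\<psi> i) = 0"
  thus "f \<in> null_space (diagonal_operator K \<psi> a)"
    by (simp add: null_space_def diagonal_operator_def)
qed

text \<open>The definite description calls for existence and uniqueness. With reciprocal
  coefficients the residual is orthogonal to every \<open>\<psi> i\<close>, hence to the range; any
  other solution differs from this one by a vector both in the null space and orthogonal to
  it.\<close>

lemma pseudo_inverse_diagonal_operator:
  assumes a: "\<And>i. i \<in> {1..K} \<Longrightarrow> a i \<noteq> 0"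
  shows "pseudo_inverse (diagonal_operator K \<psi> a) g = diagonal_operator K \<psi> (\<lambda>i. 1 / a i) g"
proof -
  let ?D = "diagonal_operator K \<psi> a" and ?g = "diagonal_operator K \<psi> (\<lambda>i. 1 / a i) g"
  let ?P = "\<lambda>h. h \<in> orthogonal_comp (null_space ?D) \<and> (\<forall>f. inner (?D h - g) (?D f) = 0)"
  show ?thesis
    unfolding pseudo_inverse_def
  proof (rule the_equality)
    have "inner f ?g = 0" if "f \<in> null_space ?D" for f
      unfolding diagonal_operator_def[of _ _ "\<lambda>i. 1 / a i"] inner_sum_right
      by (intro sum.neutral) (use that null_space_diagonal_operator[OF a] in auto)
    moreover have "inner (?D ?g - g) (?D f) = 0" for f
    proof -
      have "inner (?D ?g - g) (\<psi> i) = 0" if i: "i \<in> {1..K}" for i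
        using a[OF i] by (simp add: inner_diff_left inner_diagonal_operator[OF i])
      thus ?thesis unfolding diagonal_operator_def[of K \<psi> a f] by (simp add: inner_sum_right)
    qed
    ultimately show "?P ?g" by (auto simp: orthogonal_comp_def orthogonal_def)
    fix h assume h: "?P h"
    have orth: "inner f (h - ?g) = 0" if "f \<in> null_space ?D" for f
      using h \<open>?P ?g\<close> that by (auto simp: orthogonal_comp_def orthogonal_def inner_diff_right)
    have "inner (h - ?g) (\<psi> i) = 0" if i: "i \<in> {1..K}" for i
    proof -
      \<comment> \<open>Testing the least squares condition with \<open>f = \<psi> i\<close>
        isolates the coefficient of index \<open>i\<close>, because \<open>a i\<close> is
        nonzero.\<close>
      have "?D (\<psi> i) = (\<Sum>j=1..K. if j = i then a i *\<^sub>R \<psi> i else 0)"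
        unfolding diagonal_operator_def
        by (intro sum.cong refl) (use i orthonormal in auto)
      hence "?D (\<psi> i) = a i *\<^sub>R \<psi> i" using i by simp
      hence "inner (?D h - g) (\<psi> i) = 0" using h a[OF i] by (metis inner_scaleR_right mult_eq_0_iff)
      thus ?thesis using a[OF i]
        by (simp add: inner_diff_left inner_diagonal_operator[OF i] field_simps)
    qed
    moreover have "null_space ?D = {f. \<forall>i\<in>{1..K}. inner f (\<psi> i) = 0}"
      by (rule null_space_diagonal_operator) (rule a)
    ultimately have "h - ?g \<in> null_space ?D" by (simp del: atLeastAtMost_iff)
    from orth[OF this] show "h = ?g" by simp
  qed
qed

text \<open>The preimage is written down explicitly, and injectivity makes \<open>inv\<close> return
  it. The diagonal part annihilates \<open>p\<close>, so only \<open>r\<close> acts there and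
  \<open>p\<close> comes back multiplied by \<open>1 / r\<close>.\<close>

lemma inverse_diagonal_operator_plus:
  assumes a: "\<And>i. i \<in> {1..K} \<Longrightarrow> a i + r \<noteq> 0" and r: "r \<noteq> 0"
    and p: "\<And>i. i \<in> {1..K} \<Longrightarrow> inner p (\<psi> i) = 0"
  shows "inv (\<lambda>f. diagonal_operator K \<psi> a f + r *\<^sub>R f) ((\<Sum>i=1..K. b i *\<^sub>R \<psi> i) + p) =
         (\<Sum>i=1..K. (b i / (a i + r)) *\<^sub>R \<psi> i) + (1 / r) *\<^sub>R p" (is "inv ?A ?g = ?f")
proof -
  have inj: "inj ?A"
  proof (rule injI)
    fix f g assume eq: "?A f = ?A g"
    have co: "inner f (\<psi> i) = inner g (\<psi> i)" if i: "i \<in> {1..K}" for i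
    proof -
      have "inner (?A f) (\<psi> i) = inner (?A g) (\<psi> i)" using eq by simp
      hence "(a i + r) * inner f (\<psi> i) = (a i + r) * inner g (\<psi> i)"
        by (simp add: inner_add_left inner_diagonal_operator[OF i] algebra_simps)
      thus ?thesis using a[OF i] by simp
    qed
    have "diagonal_operator K \<psi> a f = diagonal_operator K \<psi> a g"
      unfolding diagonal_operator_def by (intro sum.cong refl) (simp add: co)
    thus "f = g" using eq r by simp
  qed
  have co: "inner ?f (\<psi> i) = b i / (a i + r)" if i: "i \<in> {1..K}" for i
    by (simp only: inner_add_left inner_sum_basis[OF i] inner_scaleR_left p[OF i])
  have "diagonal_operator K \<psi> a ?f = (\<Sum>i=1..K. (a i * (b i / (a i + r))) *\<^sub>R \<psi> i)"
    unfolding diagonal_operator_def by (intro sum.cong refl) (simp only: co)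
  hence "?A ?f = (\<Sum>i=1..K. (a i * (b i / (a i + r))) *\<^sub>R \<psi> i) +
                (\<Sum>i=1..K. (r * (b i / (a i + r))) *\<^sub>R \<psi> i) + p"
    using r by (simp add: scaleR_add_right scaleR_sum_right add.assoc)
  also have "\<dots> = (\<Sum>i=1..K. b i *\<^sub>R \<psi> i) + p"
  proof -
    have "(a i * (b i / (a i + r))) *\<^sub>R \<psi> i + (r * (b i / (a i + r))) *\<^sub>R \<psi> i = b i *\<^sub>R \<psi> i"
      if "i \<in> {1..K}" for i
      unfolding scaleR_add_left[symmetric] distrib_right[symmetric] using a[OF that] by simp
    thus ?thesis unfolding sum.distrib[symmetric] by (simp only: cong: sum.cong)
  qed
  finally have "?A ?f = ?g" .
  from inv_f_f[OF inj, of ?f, unfolded this] show ?thesis .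
qed

end

text \<open>\<open>T\<close> depends on \<open>f\<close> only through the finitely many coefficients
  \<open>inner f (\<psi> i)\<close>, so \<open>\<eta>\<close> composed with \<open>T\<close> is
  represented by a vector even if \<open>\<eta>\<close> is unbounded.\<close>

lemma (in orthonormal_system) weak_adjoint_eq:
  assumes T: "linear T" and \<eta>: "linear \<eta>"
    and null: "\<And>f. (\<And>i. i \<in> {1..K} \<Longrightarrow> inner f (\<psi> i) = 0) \<Longrightarrow> T f = 0"
  shows "weak_adjoint T \<eta> = (\<Sum>i=1..K. \<eta> (T (\<psi> i)) *\<^sub>R \<psi> i)" (is "_ = ?h")
proof -
  have expand: "T f = (\<Sum>i=1..K. inner f (\<psi> i) *\<^sub>R T (\<psi> i))" for f
  proof -
    have "T (f - (\<Sum>i=1..K. inner f (\<psi> i) *\<^sub>R \<psi> i)) = 0"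
      by (rule null) (simp only: inner_diff_left inner_sum_basis diff_self)
    thus ?thesis by (simp add: linear_diff[OF T] linear_sum[OF T] linear_cmul[OF T])
  qed
  have h: "inner ?h f = \<eta> (T f)" for f
  proof -
    have "\<eta> (T f) = \<eta> (\<Sum>i=1..K. inner f (\<psi> i) *\<^sub>R T (\<psi> i))" by (subst expand) (rule refl)
    also have "\<dots> = inner ?h f"
      unfolding inner_sum_left linear_sum[OF \<eta>] linear_cmul[OF \<eta>]
      by (simp add: inner_commute mult.commute)
    finally show ?thesis by simp
  qed
  show ?thesis
    unfolding weak_adjoint_def
  proof (rule the_equality)
    fix g assume "\<forall>f. inner g f = \<eta> (T f)"
    hence "\<forall>f. inner g f = inner ?h f" using h by simp
    thus "g = ?h" by (simp only: vector_eq_rdot)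
  qed (use h in blast)
qed


section \<open>The normal operator and the data\<close>

text \<open>The complete eigenbasis is condensed into its finite part: \<open>K\<close> orthonormal
  vectors with positive eigenvalues on which the normal operator is diagonal.\<close>

locale inverse_problem = orthonormal_system K \<psi>
  for K :: nat and \<psi> :: "nat \<Rightarrow> 'h::{real_inner,complete_space}" +
  fixes n :: nat and L :: "nat \<Rightarrow> 'h \<Rightarrow> 'y::real_inner" and mu :: "nat \<Rightarrow> real"
  assumes bounded: "k \<in> {1..n} \<Longrightarrow> bounded_linear (L k)"
    and n_pos: "n \<ge> 1"
    and normal_eq_diagonal: "normal_operator n L = diagonal_operator K \<psi> mu"
    and mu_pos: "i \<in> {1..K} \<Longrightarrow> mu i > 0"
begin

lemma inner_normal:
  "inner (normal_operator n L f) g = (1 / real n) * (\<Sum>k=1..n. inner (L k f) (L k g))"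
  by (rule inner_normal_operator) (rule bounded)

lemma null_space_normal_operator:
  "null_space (normal_operator n L) = {f. \<forall>i\<in>{1..K}. inner f (\<psi> i) = 0}"
  unfolding normal_eq_diagonal
  by (rule null_space_diagonal_operator) (use mu_pos in force)

text \<open>\<open>inner (normal_operator n L f) f\<close> is the average of the squared norms of
  the \<open>L k f\<close>, so if it is zero, each of them is.\<close>

lemma null_space_normal_operator_subset:
  assumes "f \<in> null_space (normal_operator n L)" and k: "k \<in> {1..n}"
  shows "L k f = 0"
proof -
  have "inner (normal_operator n L f) f = 0" using assms(1) by (simp add: null_space_def)
  hence "(\<Sum>k=1..n. inner (L k f) (L k f)) = 0"
    using n_pos by (simp add: inner_normal)
  hence "inner (L k f) (L k f) = 0"
    using k by (subst (asm) sum_nonneg_eq_0_iff) auto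
  thus ?thesis by simp
qed

text \<open>The coefficient at \<open>\<psi> i\<close> of the averaged adjoints applied to the
  noise, written through pairings because the noise need not be an element of the data
  space.\<close>

definition noise_coeff :: "(nat \<Rightarrow> 'w \<Rightarrow> 'y \<Rightarrow> real) \<Rightarrow> nat \<Rightarrow> 'w \<Rightarrow> real" where
  "noise_coeff W i \<omega> = (1 / real n) * (\<Sum>k=1..n. W k \<omega> (L k (\<psi> i)))"

lemma \<phi>y_expansion:
  assumes noise: "\<forall>k\<in>{1..n}. white_noise M (W k)" and \<omega>: "\<omega> \<in> space M"
    and \<phi>s: "\<phi>s = (\<Sum>i=1..K. c i *\<^sub>R \<psi> i)"
  shows "\<phi>y n L \<phi>s W \<sigma> \<omega> = (\<Sum>i=1..K. (mu i * c i + \<sigma> * noise_coeff W i \<omega>) *\<^sub>R \<psi> i)"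
proof -
  have W: "linear (W k \<omega>)" if "k \<in> {1..n}" for k
    using bspec[OF noise that] \<omega> by (simp add: white_noise_def)
  have wa: "weak_adjoint (L k) (noisy_datum (L k) \<phi>s (W k) \<sigma> \<omega>) =
      (\<Sum>i=1..K. (inner (L k \<phi>s) (L k (\<psi> i)) + \<sigma> * W k \<omega> (L k (\<psi> i))) *\<^sub>R \<psi> i)"
    if k: "k \<in> {1..n}" for k
  proof -
    have "linear (noisy_datum (L k) \<phi>s (W k) \<sigma> \<omega>)"
      unfolding noisy_datum_def
      by (rule linearI)
         (simp_all add: linear_add[OF W[OF k]] linear_cmul[OF W[OF k]] inner_add_right algebra_simps)
    hence "weak_adjoint (L k) (noisy_datum (L k) \<phi>s (W k) \<sigma> \<omega>) =
        (\<Sum>i=1..K. noisy_datum (L k) \<phi>s (W k) \<sigma> \<omega> (L k (\<psi> i)) *\<^sub>R \<psi> i)"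
      by (intro weak_adjoint_eq bounded_linear.linear[OF bounded[OF k]]
          null_space_normal_operator_subset[OF _ k])
         (auto simp: null_space_normal_operator)
    thus ?thesis by (simp add: noisy_datum_def)
  qed
  have "\<phi>y n L \<phi>s W \<sigma> \<omega> = (1 / real n) *\<^sub>R
      (\<Sum>i=1..K. \<Sum>k=1..n. (inner (L k \<phi>s) (L k (\<psi> i)) + \<sigma> * W k \<omega> (L k (\<psi> i))) *\<^sub>R \<psi> i)"
    unfolding \<phi>y_def by (subst sum.swap) (simp only: wa cong: sum.cong)
  \<comment> \<open>Averaging over \<open>k\<close> turns the signal part into the bilinear form of
    the normal operator.\<close>
  also have "\<dots> = (\<Sum>i=1..K. (inner (normal_operator n L \<phi>s) (\<psi> i) + \<sigma> * noise_coeff W i \<omega>) *\<^sub>R \<psi> i)"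
    unfolding noise_coeff_def scaleR_sum_right
    by (intro sum.cong refl)
       (simp add: inner_normal sum.distrib sum_distrib_left
         scaleR_add_left algebra_simps flip: scaleR_sum_left scaleR_sum_right)
  also have "\<dots> = (\<Sum>i=1..K. (mu i * c i + \<sigma> * noise_coeff W i \<omega>) *\<^sub>R \<psi> i)"
    by (intro sum.cong refl)
       (simp only: normal_eq_diagonal inner_diagonal_operator \<phi>s inner_sum_basis)
  finally show ?thesis .
qed

end

text \<open>By self-adjointness both operators have the same inner products with every
  \<open>\<psi> j\<close>, and these vectors span a dense subspace. This avoids expanding
  \<open>f\<close> in an infinite series.\<close>

lemma normal_operator_eq_diagonal:
  fixes L :: "nat \<Rightarrow> 'h::{real_inner,complete_space} \<Rightarrow> 'y::real_inner"
  assumes bounded: "\<And>k. k \<in> {1..n} \<Longrightarrow> bounded_linear (L k)"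
    and basis: "orthonormal_eigenbasis (normal_operator n L) J mu \<psi>"
    and K: "{1..K} \<subseteq> J" and zero: "\<And>i. i > K \<Longrightarrow> mu i = 0"
  shows "normal_operator n L = diagonal_operator K \<psi> mu"
proof
  let ?A = "normal_operator n L"
  fix f
  have J: "J \<subseteq> {1..}" using basis by (auto simp: orthonormal_eigenbasis_def)
  have orth: "inner (\<psi> i) (\<psi> j) = (if i = j then 1 else 0)" if "i \<in> J" "j \<in> J" for i j
    using basis that by (auto simp: orthonormal_eigenbasis_def)
  interpret orthonormal_system K \<psi>
    by unfold_locales (use orth K in blast)
  have "inner (?A f - diagonal_operator K \<psi> mu f) (\<psi> j) = 0" if j: "j \<in> J" for j
  proof -
    have "inner (?A f) (\<psi> j) = (1 / real n) * (\<Sum>k=1..n. inner (L k f) (L k (\<psi> j)))"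
      by (rule inner_normal_operator) (rule bounded)
    also have "\<dots> = (1 / real n) * (\<Sum>k=1..n. inner (L k (\<psi> j)) (L k f))"
      by (simp only: inner_commute)
    also have "\<dots> = inner (?A (\<psi> j)) f"
      by (rule inner_normal_operator[symmetric]) (rule bounded)
    also have "\<dots> = mu j * inner f (\<psi> j)"
      using basis j by (simp add: orthonormal_eigenbasis_def inner_commute)
    also have "\<dots> = inner (diagonal_operator K \<psi> mu f) (\<psi> j)"
    proof (cases "j \<le> K")
      case True
      thus ?thesis using j J by (subst inner_diagonal_operator) auto
    next
      \<comment> \<open>Beyond \<open>K\<close> both sides vanish: the left because
        \<open>mu j = 0\<close>, the right because \<open>\<psi> j\<close> is orthogonal to the
        first \<open>K\<close> eigenfunctions.\<close>
      case False
      have "inner (diagonal_operator K \<psi> mu f) (\<psi> j) = 0"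
        unfolding diagonal_operator_def inner_sum_left
        by (intro sum.neutral ballI) (use False K j orth in auto)
      thus ?thesis using False zero by simp
    qed
    finally show ?thesis by (simp add: inner_diff_left)
  qed
  hence "\<psi> ` J \<subseteq> {x. inner (?A f - diagonal_operator K \<psi> mu f) x = 0}" by auto
  moreover have "subspace {x. inner (?A f - diagonal_operator K \<psi> mu f) x = 0}"
    by (rule subspace_hyperplane)
  ultimately have "span (\<psi> ` J) \<subseteq> {x. inner (?A f - diagonal_operator K \<psi> mu f) x = 0}"
    by (rule span_minimal)
  hence "closure (span (\<psi> ` J)) \<subseteq> {x. inner (?A f - diagonal_operator K \<psi> mu f) x = 0}"
    by (rule closure_minimal) (rule closed_hyperplane)
  hence "inner (?A f - diagonal_operator K \<psi> mu f) x = 0" for x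
    using basis by (auto simp: orthonormal_eigenbasis_def)
  from this[of "?A f - diagonal_operator K \<psi> mu f"] show "?A f = diagonal_operator K \<psi> mu f"
    by simp
qed


section \<open>Moments of the noise\<close>

lemma (in prob_space) white_noise_moments:
  assumes W: "white_noise M W"
  shows "integrable M (\<lambda>\<omega>. W \<omega> y)" "integrable M (\<lambda>\<omega>. (W \<omega> y)\<^sup>2)"
    and "expectation (\<lambda>\<omega>. W \<omega> y) = 0"
proof -
  have "integrable M (\<lambda>\<omega>. W \<omega> y) \<and> integrable M (\<lambda>\<omega>. (W \<omega> y)\<^sup>2) \<and> expectation (\<lambda>\<omega>. W \<omega> y) = 0"
  proof (cases "y = 0")
    \<comment> \<open>The normal law is prescribed only for nonzero \<open>y\<close>. Here linearity
      gives the value 0, but only for \<open>\<omega>\<close> in \<open>space M\<close>, hence the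
      congruence rules.\<close>
    case True
    have 0: "W \<omega> y = 0" if "\<omega> \<in> space M" for \<omega>
      using W that True by (simp add: white_noise_def linear_0)
    have "integrable M (\<lambda>\<omega>. W \<omega> y) = integrable M (\<lambda>_. 0 :: real)"
      by (rule Bochner_Integration.integrable_cong) (simp_all add: 0)
    moreover have "integrable M (\<lambda>\<omega>. (W \<omega> y)\<^sup>2) = integrable M (\<lambda>_. 0 :: real)"
      by (rule Bochner_Integration.integrable_cong) (simp_all add: 0)
    moreover have "expectation (\<lambda>\<omega>. W \<omega> y) = expectation (\<lambda>_. 0)"
      by (rule Bochner_Integration.integral_cong) (simp_all add: 0)
    ultimately show ?thesis by simp
  next
    case False
    hence D: "distributed M lborel (\<lambda>\<omega>. W \<omega> y) (normal_density 0 (norm y))" and y: "norm y > 0"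
      using W by (auto simp: white_noise_def)
    show ?thesis
      using distributed_integrable[OF D, of "\<lambda>x. x"] distributed_integrable[OF D, of "\<lambda>x. x\<^sup>2"]
        integrable_normal_moment[OF y, of 0 1] integrable_normal_moment[OF y, of 0 2]
        normal_distributed_expectation[OF y D]
      by (simp add: normal_density_nonneg)
  qed
  thus "integrable M (\<lambda>\<omega>. W \<omega> y)" "integrable M (\<lambda>\<omega>. (W \<omega> y)\<^sup>2)"
    "expectation (\<lambda>\<omega>. W \<omega> y) = 0" by auto
qed

text \<open>Induction with \<open>(x + y)\<^sup>2 \<le> 2 * x\<^sup>2 + 2 * y\<^sup>2\<close>, valid
  whatever the joint law of the summands. Integrability of each \<open>f i\<close> supplies
  measurability.\<close>

lemma integrable_power2_sum:
  fixes f :: "'i \<Rightarrow> 'w \<Rightarrow> real"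
  assumes "finite A" "\<And>i. i \<in> A \<Longrightarrow> integrable M (f i)" "\<And>i. i \<in> A \<Longrightarrow> integrable M (\<lambda>\<omega>. (f i \<omega>)\<^sup>2)"
  shows "integrable M (\<lambda>\<omega>. (\<Sum>i\<in>A. f i \<omega>)\<^sup>2)"
  using assms
proof (induction A)
  case (insert a A)
  have "integrable M (\<lambda>\<omega>. (f a \<omega> + (\<Sum>i\<in>A. f i \<omega>))\<^sup>2)"
  proof (rule Bochner_Integration.integrable_bound)
    show "integrable M (\<lambda>\<omega>. 2 * (f a \<omega>)\<^sup>2 + 2 * (\<Sum>i\<in>A. f i \<omega>)\<^sup>2)"
      using insert by (intro Bochner_Integration.integrable_add integrable_mult_right) auto
    show "(\<lambda>\<omega>. (f a \<omega> + (\<Sum>i\<in>A. f i \<omega>))\<^sup>2) \<in> borel_measurable M"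
      using insert.prems(1)
      by (intro borel_measurable_power borel_measurable_add borel_measurable_sum
          borel_measurable_integrable) auto
    have "(x + y)\<^sup>2 \<le> 2 * x\<^sup>2 + 2 * y\<^sup>2" for x y :: real
      using sum_squares_bound[of x y] by (simp add: power2_sum)
    thus "AE \<omega> in M. norm ((f a \<omega> + (\<Sum>i\<in>A. f i \<omega>))\<^sup>2)
        \<le> norm (2 * (f a \<omega>)\<^sup>2 + 2 * (\<Sum>i\<in>A. f i \<omega>)\<^sup>2)"
      by simp
  qed
  thus ?case using insert by simp
qed simp

text \<open>The zero mean removes the cross term in the lower bound for the bias; the finite second
  moment makes the constant in the upper bound finite.\<close>

lemma (in inverse_problem) noise_coeff_moments:
  assumes "prob_space M" and W: "\<forall>k\<in>{1..n}. white_noise M (W k)"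
  shows "integrable M (noise_coeff W i)" "integrable M (\<lambda>\<omega>. (noise_coeff W i \<omega>)\<^sup>2)"
    and "integral\<^sup>L M (noise_coeff W i) = 0"
proof -
  interpret prob_space M by fact
  have m: "integrable M (\<lambda>\<omega>. W k \<omega> y)" "integrable M (\<lambda>\<omega>. (W k \<omega> y)\<^sup>2)"
    "expectation (\<lambda>\<omega>. W k \<omega> y) = 0" if "k \<in> {1..n}" for k y
    using white_noise_moments[of "W k" y] W that by simp_all
  show "integrable M (noise_coeff W i)"
    unfolding noise_coeff_def[abs_def]
    by (intro integrable_mult_right Bochner_Integration.integrable_sum m)
  show "integrable M (\<lambda>\<omega>. (noise_coeff W i \<omega>)\<^sup>2)"
    unfolding noise_coeff_def power_mult_distrib
    by (intro integrable_mult_right integrable_power2_sum m) auto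
  show "integral\<^sup>L M (noise_coeff W i) = 0"
  proof -
    have "integral\<^sup>L M (noise_coeff W i) = (1 / real n) * (\<Sum>k=1..n. expectation (\<lambda>\<omega>. W k \<omega> (L k (\<psi> i))))"
      unfolding noise_coeff_def[abs_def] integral_mult_right_zero
      by (subst Bochner_Integration.integral_sum) (auto intro: m)
    also have "(\<Sum>k=1..n. expectation (\<lambda>\<omega>. W k \<omega> (L k (\<psi> i)))) = 0"
      by (intro sum.neutral ballI m)
    finally show ?thesis by simp
  qed
qed


section \<open>The two estimators\<close>

context inverse_problem
begin

text \<open>A small hyper-parameter amplifies the perturbation in the null space, a large one shrinks the
  coefficient of any eigenfunction occurring in the true function.\<close>

lemma L2_regularized_bias_bounded_below:
  assumes M: "prob_space M" and W: "\<forall>k\<in>{1..n}. white_noise M (W k)"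
    and \<phi>s: "\<phi>s = (\<Sum>i=1..K. c i *\<^sub>R \<psi> i)"
    and eps: "\<phi>eps \<in> null_space (normal_operator n L)"
    and j: "j \<in> {1..K}"
  shows "ennreal (min ((norm \<phi>eps)\<^sup>2) ((c j / (mu j + 1))\<^sup>2)) \<le> minimal_bias M \<phi>s
    (\<lambda>lam \<omega>. L2_regularized (normal_operator n L) lam (\<phi>y n L \<phi>s W \<sigma> \<omega> + \<phi>eps))"
  unfolding minimal_bias_def
proof (rule INF_greatest)
  interpret prob_space M by fact
  fix lam :: real assume "lam \<in> {0<..}"
  hence lam: "lam > 0" by simp
  let ?N = "\<lambda>i \<omega>. noise_coeff W i \<omega>"
  let ?err = "\<lambda>\<omega>. L2_regularized (normal_operator n L) lam (\<phi>y n L \<phi>s W \<sigma> \<omega> + \<phi>eps) - \<phi>s"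
  note m = noise_coeff_moments[OF M W]
  have perp: "inner \<phi>eps (\<psi> i) = 0" if "i \<in> {1..K}" for i
    using eps that unfolding null_space_normal_operator by blast
  have pos: "mu i + lam > 0" if "i \<in> {1..K}" for i using mu_pos[OF that] lam by simp
  \<comment> \<open>Three contributions: noise, shrinkage \<open>- lam * c i\<close> of the true
    coefficients, and the perturbation divided by \<open>lam\<close>. The last is orthogonal to the
    others, so Pythagoras applies next.\<close>
  have err: "?err \<omega> = (\<Sum>i=1..K. ((\<sigma> * ?N i \<omega> - lam * c i) / (mu i + lam)) *\<^sub>R \<psi> i) + (1 / lam) *\<^sub>R \<phi>eps"
    if \<omega>: "\<omega> \<in> space M" for \<omega>
  proof -
    have "L2_regularized (normal_operator n L) lam (\<phi>y n L \<phi>s W \<sigma> \<omega> + \<phi>eps) =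
        (\<Sum>i=1..K. ((mu i * c i + \<sigma> * ?N i \<omega>) / (mu i + lam)) *\<^sub>R \<psi> i) + (1 / lam) *\<^sub>R \<phi>eps"
      unfolding L2_regularized_def normal_eq_diagonal
      by (subst \<phi>y_expansion[OF W \<omega> \<phi>s], rule inverse_diagonal_operator_plus)
         (use pos lam perp in force)+
    hence "?err \<omega> = (\<Sum>i=1..K. ((mu i * c i + \<sigma> * ?N i \<omega>) / (mu i + lam) - c i) *\<^sub>R \<psi> i)
        + (1 / lam) *\<^sub>R \<phi>eps"
      by (simp add: \<phi>s scaleR_diff_left sum_subtractf)
    also have "(\<Sum>i=1..K. ((mu i * c i + \<sigma> * ?N i \<omega>) / (mu i + lam) - c i) *\<^sub>R \<psi> i) =
        (\<Sum>i=1..K. ((\<sigma> * ?N i \<omega> - lam * c i) / (mu i + lam)) *\<^sub>R \<psi> i)"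
    proof (intro sum.cong refl)
      fix i assume "i \<in> {1..K}"
      from pos[OF this] have "(mu i * c i + \<sigma> * ?N i \<omega>) / (mu i + lam) - c i =
          (\<sigma> * ?N i \<omega> - lam * c i) / (mu i + lam)"
        by (simp add: field_simps)
      thus "((mu i * c i + \<sigma> * ?N i \<omega>) / (mu i + lam) - c i) *\<^sub>R \<psi> i =
          ((\<sigma> * ?N i \<omega> - lam * c i) / (mu i + lam)) *\<^sub>R \<psi> i" by simp
    qed
    finally show ?thesis .
  qed
  have norm_err: "(norm (?err \<omega>))\<^sup>2 =
      (\<Sum>i=1..K. ((\<sigma> * ?N i \<omega> - lam * c i) / (mu i + lam))\<^sup>2) + (norm \<phi>eps / lam)\<^sup>2"
    if \<omega>: "\<omega> \<in> space M" for \<omega>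
  proof -
    have "orthogonal (\<Sum>i=1..K. ((\<sigma> * ?N i \<omega> - lam * c i) / (mu i + lam)) *\<^sub>R \<psi> i) ((1 / lam) *\<^sub>R \<phi>eps)"
      unfolding orthogonal_def inner_sum_left
      by (intro sum.neutral ballI) (simp add: perp inner_commute[of _ \<phi>eps])
    from norm_add_Pythagorean[OF this] show ?thesis
      using lam unfolding err[OF \<omega>] norm_sum_basis by (simp add: power_divide)
  qed
  show "ennreal (min ((norm \<phi>eps)\<^sup>2) ((c j / (mu j + 1))\<^sup>2)) \<le> (\<integral>\<^sup>+\<omega>. ennreal ((norm (?err \<omega>))\<^sup>2) \<partial>M)"
  proof (cases "lam \<le> 1")
    case True
    have "(norm \<phi>eps)\<^sup>2 \<le> (norm (?err \<omega>))\<^sup>2" if "\<omega> \<in> space M" for \<omega>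
    proof -
      have "norm \<phi>eps \<le> norm \<phi>eps / lam"
        using True lam by (simp add: pos_le_divide_eq mult_left_le)
      hence "(norm \<phi>eps)\<^sup>2 \<le> (norm \<phi>eps / lam)\<^sup>2" by (rule power_mono) simp
      thus ?thesis unfolding norm_err[OF that] by (simp add: add_increasing sum_nonneg)
    qed
    hence "(\<integral>\<^sup>+\<omega>. ennreal ((norm \<phi>eps)\<^sup>2) \<partial>M) \<le> (\<integral>\<^sup>+\<omega>. ennreal ((norm (?err \<omega>))\<^sup>2) \<partial>M)"
      by (intro nn_integral_mono ennreal_leI)
    hence "ennreal ((norm \<phi>eps)\<^sup>2) \<le> (\<integral>\<^sup>+\<omega>. ennreal ((norm (?err \<omega>))\<^sup>2) \<partial>M)"
      by (simp add: emeasure_space_1)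
    thus ?thesis by (rule order_trans[rotated]) (simp add: ennreal_leI)
  next
    case False
    \<comment> \<open>Only the term of index \<open>j\<close> is kept: \<open>a\<close> is its
      deterministic shrinkage error and \<open>b\<close> the factor of its noise.\<close>
    define a where "a = lam * c j / (mu j + lam)"
    define b where "b = \<sigma> / (mu j + lam)"
    have mu: "mu j > 0" by (rule mu_pos[OF j])
    have sq: "(b * x - a)\<^sup>2 = b\<^sup>2 * x\<^sup>2 - (2 * a * b) * x + a\<^sup>2" for x
      by (simp add: power2_eq_square algebra_simps)
    have int: "integrable M (\<lambda>\<omega>. (b * ?N j \<omega> - a)\<^sup>2)"
      unfolding sq by (intro Bochner_Integration.integrable_add Bochner_Integration.integrable_diff
          integrable_mult_right m integrable_const)
    \<comment> \<open>The noise is centred, so the cross term drops out and noise can only increase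
      the error.\<close>
    have "expectation (\<lambda>\<omega>. (b * ?N j \<omega> - a)\<^sup>2) = b\<^sup>2 * expectation (\<lambda>\<omega>. (?N j \<omega>)\<^sup>2) + a\<^sup>2"
      unfolding sq using m[of j] by (simp add: prob_space)
    hence "a\<^sup>2 \<le> expectation (\<lambda>\<omega>. (b * ?N j \<omega> - a)\<^sup>2)" by (simp add: integral_nonneg)
    hence "ennreal (a\<^sup>2) \<le> (\<integral>\<^sup>+\<omega>. ennreal ((b * ?N j \<omega> - a)\<^sup>2) \<partial>M)"
      by (subst nn_integral_eq_integral[OF int]) (auto intro: ennreal_leI)
    also have "\<dots> \<le> (\<integral>\<^sup>+\<omega>. ennreal ((norm (?err \<omega>))\<^sup>2) \<partial>M)"
    proof (intro nn_integral_mono ennreal_leI)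
      fix \<omega> assume \<omega>: "\<omega> \<in> space M"
      have "(b * ?N j \<omega> - a)\<^sup>2 = ((\<sigma> * ?N j \<omega> - lam * c j) / (mu j + lam))\<^sup>2"
        by (simp add: a_def b_def diff_divide_distrib)
      also have "\<dots> \<le> (\<Sum>i=1..K. ((\<sigma> * ?N i \<omega> - lam * c i) / (mu i + lam))\<^sup>2)"
        by (rule member_le_sum) (use j in auto)
      also have "\<dots> \<le> (norm (?err \<omega>))\<^sup>2" unfolding norm_err[OF \<omega>] by simp
      finally show "(b * ?N j \<omega> - a)\<^sup>2 \<le> (norm (?err \<omega>))\<^sup>2" .
    qed
    finally have le: "ennreal (a\<^sup>2) \<le> (\<integral>\<^sup>+\<omega>. ennreal ((norm (?err \<omega>))\<^sup>2) \<partial>M)" .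
    have "\<bar>c j / (mu j + 1)\<bar> \<le> \<bar>a\<bar>"
    proof -
      \<comment> \<open>\<open>lam / (mu j + lam)\<close> increases with \<open>lam\<close>, so its
        value at the threshold 1 is a lower bound.\<close>
      have "1 / (mu j + 1) \<le> lam / (mu j + lam)"
        using mu lam False by (simp add: field_simps)
      hence "\<bar>c j\<bar> * (1 / (mu j + 1)) \<le> \<bar>c j\<bar> * (lam / (mu j + lam))" by (rule mult_left_mono) simp
      thus ?thesis using mu lam by (simp add: a_def abs_mult mult.commute)
    qed
    hence "(c j / (mu j + 1))\<^sup>2 \<le> a\<^sup>2" by (rule abs_le_square_iff[THEN iffD1])
    thus ?thesis by (intro order_trans[OF _ le] ennreal_leI) simp
  qed
qed

text \<open>The choice \<open>lam = \<sigma>\<close> balances the noise against the regularization error.\<close>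

lemma fractional_regularized_bias_bounded_above:
  assumes M: "prob_space M" and W: "\<forall>k\<in>{1..n}. white_noise M (W k)"
    and \<phi>s: "\<phi>s = (\<Sum>i=1..K. c i *\<^sub>R \<psi> i)"
    and eps: "\<phi>eps \<in> null_space (normal_operator n L)"
  obtains C where "C < \<infinity>"
    and "\<And>\<sigma>. \<sigma> > 0 \<Longrightarrow> minimal_bias M \<phi>s (\<lambda>lam \<omega>. fractional_regularized (normal_operator n L) K mu \<psi> s lam
           (\<phi>y n L \<phi>s W \<sigma> \<omega> + \<phi>eps)) \<le> ennreal (\<sigma>\<^sup>2) * C"
proof -
  interpret prob_space M by fact
  let ?N = "\<lambda>i \<omega>. noise_coeff W i \<omega>"
  let ?r = "\<lambda>i. mu i powr s"
  let ?F = "fractional_regularized (normal_operator n L) K mu \<psi> s"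
  \<comment> \<open>A bound for the squared error divided by \<open>\<sigma>\<^sup>2\<close> that
    does not depend on \<open>\<sigma>\<close>; its expectation serves as \<open>C\<close>.\<close>
  define B where "B \<omega> = (\<Sum>i=1..K. 2 * ((?N i \<omega>)\<^sup>2 + (c i / ?r i)\<^sup>2) / (mu i)\<^sup>2)" for \<omega>
  note m = noise_coeff_moments[OF M W]
  have "integrable M B"
    unfolding B_def[abs_def]
    by (intro Bochner_Integration.integrable_sum integrable_divide integrable_mult_right
        Bochner_Integration.integrable_add m integrable_const)
  moreover have "B \<omega> \<ge> 0" for \<omega> by (simp add: B_def sum_nonneg)
  ultimately have finite: "(\<integral>\<^sup>+\<omega>. ennreal (B \<omega>) \<partial>M) < \<infinity>"
    and meas: "(\<lambda>\<omega>. ennreal (B \<omega>)) \<in> borel_measurable M"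
    by (auto simp: nn_integral_eq_integral)
  have perp: "inner \<phi>eps (\<psi> i) = 0" if "i \<in> {1..K}" for i
    using eps that unfolding null_space_normal_operator by blast
  have r: "?r i > 0" if "i \<in> {1..K}" for i using mu_pos[OF that] by simp
  have F: "?F lam g = diagonal_operator K \<psi> (\<lambda>i. 1 / (mu i + lam / ?r i)) g" if lam: "lam > 0" for lam g
  proof -
    have "?F lam g = pseudo_inverse (\<lambda>f. diagonal_operator K \<psi> mu f +
        lam *\<^sub>R diagonal_operator K \<psi> (\<lambda>i. 1 / ?r i) f) g"
      unfolding fractional_regularized_def operator_power_eq_diagonal normal_eq_diagonal
      by (subst pseudo_inverse_diagonal_operator) (use r in force, rule refl)
    also have "\<dots> = pseudo_inverse (diagonal_operator K \<psi> (\<lambda>i. mu i + lam * (1 / ?r i))) g"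
      unfolding diagonal_operator_add_scaleR ..
    also have "\<dots> = diagonal_operator K \<psi> (\<lambda>i. 1 / (mu i + lam * (1 / ?r i))) g"
    proof (rule pseudo_inverse_diagonal_operator)
      fix i assume i: "i \<in> {1..K}"
      have "mu i + lam * (1 / ?r i) > 0"
        using mu_pos[OF i] r[OF i] lam by (intro add_pos_pos mult_pos_pos divide_pos_pos) auto
      thus "mu i + lam * (1 / ?r i) \<noteq> 0" by simp
    qed
    finally show ?thesis by simp
  qed
  have bound: "(norm (?F \<sigma> (\<phi>y n L \<phi>s W \<sigma> \<omega> + \<phi>eps) - \<phi>s))\<^sup>2 \<le> \<sigma>\<^sup>2 * B \<omega>"
    if \<sigma>: "\<sigma> > 0" and \<omega>: "\<omega> \<in> space M" for \<sigma> \<omega>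
  proof -
    let ?e = "\<lambda>i. (mu i * c i + \<sigma> * ?N i \<omega>) / (mu i + \<sigma> / ?r i) - c i"
    \<comment> \<open>The perturbation is orthogonal to every \<open>\<psi> i\<close>, so the
      diagonal operator removes it.\<close>
    have "?F \<sigma> (\<phi>y n L \<phi>s W \<sigma> \<omega> + \<phi>eps) =
        (\<Sum>i=1..K. ((mu i * c i + \<sigma> * ?N i \<omega>) / (mu i + \<sigma> / ?r i)) *\<^sub>R \<psi> i)"
      unfolding F[OF \<sigma>] diagonal_operator_def
      by (subst \<phi>y_expansion[OF W \<omega> \<phi>s])
         (intro sum.cong refl, simp only: inner_add_left inner_sum_basis perp, simp)
    hence "(norm (?F \<sigma> (\<phi>y n L \<phi>s W \<sigma> \<omega> + \<phi>eps) - \<phi>s))\<^sup>2 = (norm (\<Sum>i=1..K. ?e i *\<^sub>R \<psi> i))\<^sup>2"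
      by (simp add: \<phi>s scaleR_diff_left sum_subtractf)
    also have "\<dots> = (\<Sum>i=1..K. (?e i)\<^sup>2)" by (rule norm_sum_basis)
    also have "\<dots> \<le> (\<Sum>i=1..K. \<sigma>\<^sup>2 * (2 * ((?N i \<omega>)\<^sup>2 + (c i / ?r i)\<^sup>2) / (mu i)\<^sup>2))"
    proof (rule sum_mono)
      fix i assume i: "i \<in> {1..K}"
      define d where "d = mu i + \<sigma> / ?r i"
      have d: "mu i \<le> d" "0 < d" using mu_pos[OF i] r[OF i] \<sigma> by (auto simp: d_def add_pos_pos)
      have "?e i = \<sigma> * (?N i \<omega> - c i / ?r i) / d"
      proof -
        \<comment> \<open>Since \<open>lam = \<sigma>\<close>, the terms \<open>mu i * c i\<close>
          cancel and the factor \<open>\<sigma>\<close> comes out of both noise and regularization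
          error.\<close>
        have "?e i = (mu i * c i + \<sigma> * ?N i \<omega> - c i * d) / d"
          using d(2) unfolding d_def[symmetric] by (simp add: diff_divide_distrib)
        also have "mu i * c i + \<sigma> * ?N i \<omega> - c i * d = \<sigma> * (?N i \<omega> - c i / ?r i)"
          by (simp add: d_def algebra_simps)
        finally show ?thesis .
      qed
      hence "(?e i)\<^sup>2 = \<sigma>\<^sup>2 * ((?N i \<omega> - c i / ?r i)\<^sup>2 / d\<^sup>2)"
        by (simp add: power_divide power_mult_distrib)
      \<comment> \<open>Replacing \<open>d\<close> by the smaller \<open>mu i\<close> makes the
        bound uniform in \<open>\<sigma>\<close>.\<close>
      also have "\<dots> \<le> \<sigma>\<^sup>2 * ((2 * ((?N i \<omega>)\<^sup>2 + (c i / ?r i)\<^sup>2)) / (mu i)\<^sup>2)"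
      proof (intro mult_left_mono frac_le)
        have "(x - y)\<^sup>2 \<le> 2 * (x\<^sup>2 + y\<^sup>2)" for x y :: real
          using zero_le_power2[of "x + y"] by (simp add: power2_sum power2_diff)
        thus "(?N i \<omega> - c i / ?r i)\<^sup>2 \<le> 2 * ((?N i \<omega>)\<^sup>2 + (c i / ?r i)\<^sup>2)" .
        show "(mu i)\<^sup>2 \<le> d\<^sup>2" using d(1) mu_pos[OF i] by (intro power_mono) auto
      qed (use mu_pos[OF i] in auto)
      finally show "(?e i)\<^sup>2 \<le> \<sigma>\<^sup>2 * (2 * ((?N i \<omega>)\<^sup>2 + (c i / ?r i)\<^sup>2) / (mu i)\<^sup>2)" .
    qed
    finally show ?thesis by (simp add: B_def sum_distrib_left)
  qed
  show thesis
  proof (rule that)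
    show "(\<integral>\<^sup>+\<omega>. ennreal (B \<omega>) \<partial>M) < \<infinity>" by (rule finite)
    fix \<sigma> :: real assume \<sigma>: "\<sigma> > 0"
    have "minimal_bias M \<phi>s (\<lambda>lam \<omega>. ?F lam (\<phi>y n L \<phi>s W \<sigma> \<omega> + \<phi>eps)) \<le>
        (\<integral>\<^sup>+\<omega>. ennreal ((norm (?F \<sigma> (\<phi>y n L \<phi>s W \<sigma> \<omega> + \<phi>eps) - \<phi>s))\<^sup>2) \<partial>M)"
      unfolding minimal_bias_def by (rule INF_lower) (use \<sigma> in simp)
    also have "\<dots> \<le> (\<integral>\<^sup>+\<omega>. ennreal (\<sigma>\<^sup>2) * ennreal (B \<omega>) \<partial>M)"
      by (intro nn_integral_mono)
         (simp add: bound[OF \<sigma>] ennreal_leI flip: ennreal_mult')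
    also have "\<dots> = ennreal (\<sigma>\<^sup>2) * (\<integral>\<^sup>+\<omega>. ennreal (B \<omega>) \<partial>M)"
      by (rule nn_integral_cmult[OF meas])
    finally show "minimal_bias M \<phi>s (\<lambda>lam \<omega>. ?F lam (\<phi>y n L \<phi>s W \<sigma> \<omega> + \<phi>eps)) \<le>
        ennreal (\<sigma>\<^sup>2) * (\<integral>\<^sup>+\<omega>. ennreal (B \<omega>) \<partial>M)" .
  qed
qed

end

section \<open>Limits of the bias as the noise strength tends to zero\<close>

lemma vanishing_if_le_power2:
  assumes "C < \<infinity>" and "\<And>\<sigma>. \<sigma> > 0 \<Longrightarrow> b \<sigma> \<le> ennreal (\<sigma>\<^sup>2) * C"
  shows "vanishing b"
proof -
  obtain r where r: "C = ennreal r" "r \<ge> 0" using assms(1) by (cases C) auto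
  have upper: "\<forall>\<^sub>F \<sigma> in at_right 0. b \<sigma> \<le> ennreal (\<sigma>\<^sup>2 * r)"
    using eventually_at_right_less[of 0]
    by eventually_elim (use assms(2) r in \<open>simp add: ennreal_mult\<close>)
  have "((\<lambda>\<sigma>. \<sigma>\<^sup>2 * r) \<longlongrightarrow> 0\<^sup>2 * r) (at_right 0)" by (intro tendsto_intros)
  hence "((\<lambda>\<sigma>. ennreal (\<sigma>\<^sup>2 * r)) \<longlongrightarrow> ennreal (0\<^sup>2 * r)) (at_right 0)" by (rule tendsto_ennrealI)
  hence "((\<lambda>\<sigma>. ennreal (\<sigma>\<^sup>2 * r)) \<longlongrightarrow> 0) (at_right 0)" by simp
  from tendsto_sandwich[OF _ upper tendsto_const this] show ?thesis
    unfolding vanishing_def by simp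
qed

lemma not_vanishing_if_bounded_below:
  assumes "\<delta> > 0" and "\<And>\<sigma>. \<delta> \<le> b \<sigma>"
  shows "\<not> vanishing b"
proof
  assume "vanishing b"
  hence "\<forall>\<^sub>F \<sigma> in at_right 0. b \<sigma> < \<delta>"
    unfolding vanishing_def using assms(1) by (rule order_tendstoD(2))
  hence "\<forall>\<^sub>F \<sigma>::real in at_right 0. False"
    by eventually_elim (use assms(2) in \<open>simp add: leD\<close>)
  thus False by simp
qed

theorem proposition3p1:
  fixes \<rho> :: "'x::second_countable_topology measure"
    and cls :: "('x \<Rightarrow> real) \<Rightarrow> 'h::{real_inner,complete_space}"
    and L :: "nat \<Rightarrow> 'h \<Rightarrow> 'y::{real_inner,complete_space}"
    and M :: "'w measure"
    and W :: "nat \<Rightarrow> 'w \<Rightarrow> 'y \<Rightarrow> real"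
    and n K :: nat
    and J :: "nat set"
    and mu c :: "nat \<Rightarrow> real"
    and \<psi> :: "nat \<Rightarrow> 'h"
    and \<phi>s \<phi>eps :: 'h
    and s :: real
  defines "Lbar \<equiv> normal_operator n L"
  assumes rho: "prob_space \<rho>" "sets \<rho> = sets borel" "compact (measure_support \<rho>)"
    and L2: "is_L2_space \<rho> cls"
    and n: "n \<ge> 1"
    and L: "\<forall>k\<in>{1..n}. bounded_linear (L k)"
    and noise: "prob_space M" "\<forall>k\<in>{1..n}. white_noise M (W k)"
    and basis: "orthonormal_eigenbasis Lbar J mu \<psi>"
    and descending: "\<forall>i\<ge>1. \<forall>j\<ge>i. mu j \<le> mu i"
    and rank: "K \<in> J" "mu K > 0" "\<forall>i>K. mu i = 0"
    and perturbation: "\<phi>eps \<in> null_space Lbar" "\<phi>eps \<noteq> 0"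
    and truth: "\<phi>s = (\<Sum>i=1..K. c i *\<^sub>R \<psi> i)"
    and s: "s \<ge> 0"
  shows "(\<phi>s \<noteq> 0 \<longrightarrow>
           \<not> vanishing (\<lambda>\<sigma>. minimal_bias M \<phi>s
               (\<lambda>lam \<omega>. L2_regularized Lbar lam (\<phi>y n L \<phi>s W \<sigma> \<omega> + \<phi>eps)))) \<and>
         vanishing (\<lambda>\<sigma>. minimal_bias M \<phi>s
           (\<lambda>lam \<omega>. fractional_regularized Lbar K mu \<psi> s lam (\<phi>y n L \<phi>s W \<sigma> \<omega> + \<phi>eps)))"
proof -
  have basis': "J = {1..} \<or> (\<exists>d. J = {1..d})"
    "\<And>i j. i \<in> J \<Longrightarrow> j \<in> J \<Longrightarrow> inner (\<psi> i) (\<psi> j) = (if i = j then 1 else 0)"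
    using basis by (auto simp: orthonormal_eigenbasis_def)
  \<comment> \<open>Both admissible shapes of \<open>J\<close> are initial segments starting at
    1.\<close>
  have K: "{1..K} \<subseteq> J" using basis'(1) rank(1) by auto
  have normal: "normal_operator n L = diagonal_operator K \<psi> mu"
    using L basis K rank(3) unfolding Lbar_def by (intro normal_operator_eq_diagonal) auto
  interpret inverse_problem K \<psi> n L mu
  proof (intro inverse_problem.intro orthonormal_system.intro inverse_problem_axioms.intro)
    show "inner (\<psi> i) (\<psi> j) = (if i = j then 1 else 0)" if "i \<in> {1..K}" "j \<in> {1..K}" for i j
      by (rule basis'(2)) (use K that in auto)
    show "mu i > 0" if "i \<in> {1..K}" for i
      by (rule less_le_trans[OF rank(2)]) (use descending that in auto)
    show "bounded_linear (L k)" if "k \<in> {1..n}" for k using L that by (rule bspec)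
  qed (rule n, rule normal)
  note eps = perturbation(1)[unfolded Lbar_def]
  show ?thesis
  proof (intro conjI impI)
    \<comment> \<open>For \<open>\<phi>s = 0\<close> the claim would fail: letting
      \<open>lam\<close> grow sends the estimator, perturbation included, to 0 in mean square, so
      the infimum is 0. A nonzero \<open>\<phi>s\<close> has a nonzero coefficient, which rules this
      out.\<close>
    assume "\<phi>s \<noteq> 0"
    hence "(\<Sum>i=1..K. c i *\<^sub>R \<psi> i) \<noteq> 0" unfolding truth .
    then obtain j where j: "j \<in> {1..K}" "c j *\<^sub>R \<psi> j \<noteq> 0"
      by (rule sum.not_neutral_contains_not_neutral)
    hence "c j \<noteq> 0" by (metis scaleR_zero_left)
    have "0 < min ((norm \<phi>eps)\<^sup>2) ((c j / (mu j + 1))\<^sup>2)"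
      using perturbation(2) \<open>c j \<noteq> 0\<close> mu_pos[OF j(1)] by simp
    thus "\<not> vanishing (\<lambda>\<sigma>. minimal_bias M \<phi>s
        (\<lambda>lam \<omega>. L2_regularized Lbar lam (\<phi>y n L \<phi>s W \<sigma> \<omega> + \<phi>eps)))"
      unfolding Lbar_def
      by (intro not_vanishing_if_bounded_below[of "ennreal (min ((norm \<phi>eps)\<^sup>2) ((c j / (mu j + 1))\<^sup>2))"]
          L2_regularized_bias_bounded_below[OF noise truth eps j(1)])
         (simp only: ennreal_less_zero_iff)
  next
    show "vanishing (\<lambda>\<sigma>. minimal_bias M \<phi>s
        (\<lambda>lam \<omega>. fractional_regularized Lbar K mu \<psi> s lam (\<phi>y n L \<phi>s W \<sigma> \<omega> + \<phi>eps)))"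
      unfolding Lbar_def
      by (rule fractional_regularized_bias_bounded_above[OF noise truth eps])
         (rule vanishing_if_le_power2, assumption)
  qed
qed

end
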